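(* Let $G$ be an amenable countable infinite group and $\varphi : G \to [0,+\infty)$ a proper function with $\varphi(g) > 0$ for all $g \neq e$. Then there exists a 1-cocycle $c : G \to \ell^2(G)$ such that $\|c_g\|_2 \leq \varphi(g)$ for every $g \in G$ and such that $g \mapsto \|c_g\|_2$ is proper. More concretely, given $\varphi$, given any F{\o}lner sequence $A_n \subset G$ with all $A_n$ being disjoint and given $\delta > 0$, we can pass to a subsequence of $(A_n)$ and choose $\varepsilon_n \in (0,\delta)$ such that - $\lim_n \varepsilon_n = 0$ and $\sum_n \varepsilon_n^2 = +\infty$, - the function $$F : G \to [0,\delta) : F(g) = \begin{cases} \varepsilon_n / \sqrt{|A_n|} & \text{if } g \in A_n \text{ for some } n, \\ 0 & \text{if } g \notin \bigcup_n A_n,\end{cases}$$ is such that $c_g(k) = F(k) - F(g^{-1}k)$ defines a 1-cocycle $c : G \to \ell^2(G)$ with the properties that $\|c_g\|_2 \leq \varphi(g)$ for every $g \in G$ and that $g \mapsto \|c_g\|_2$ is proper.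
   Context: A function $\varphi : I \to [0,+\infty)$ on a countable infinite set $I$ is proper if $\{i \in I \mid \varphi(i) \leq \kappa\}$ is finite for every $\kappa > 0$. A 1-cocycle $c : G \to \ell^2(G)$ is a map satisfying $c_{gh} = c_g + g \cdot c_h$ for all $g,h\in G$, where $G$ acts on $\ell^2(G)$ by the left regular representation $(g\cdot\xi)(k) = \xi(g^{-1}k)$. A F{\o}lner sequence is a sequence of finite nonempty subsets $A_n \subset G$ satisfying $\lim_n |gA_n \triangle A_n|/|A_n| = 0$ for all $g \in G$. *)

theory Defs
  imports "HOL-Analysis.Analysis" "HOL-Algebra.Coset"
begin

text \<open>
  The type is \<open>real\<close>, so nonnegativity on \<open>I\<close> has to be required separately where it is not
  automatic.
\<close>

definition proper_on :: "'a set \<Rightarrow> ('a \<Rightarrow> real) \<Rightarrow> bool"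
  where "proper_on I \<phi> \<longleftrightarrow> (\<forall>\<kappa>>0. finite {i \<in> I. \<phi> i \<le> \<kappa>})"

text \<open>
  Vectors of \<open>\<ell>\<^sup>2(I)\<close> are represented by complex functions on the whole type; only their values
  on \<open>I\<close> matter, so equality of vectors is equality of values on \<open>I\<close>. Since \<open>infsum\<close> is \<open>0\<close> for
  families that are not summable, \<open>ell2_norm\<close> is meaningful on \<open>ell2 I\<close> only.
\<close>

definition ell2 :: "'a set \<Rightarrow> ('a \<Rightarrow> complex) set"
  where "ell2 I = {\<xi>. (\<lambda>k. (cmod (\<xi> k))\<^sup>2) summable_on I}"

definition ell2_norm :: "'a set \<Rightarrow> ('a \<Rightarrow> complex) \<Rightarrow> real"
  where "ell2_norm I \<xi> = sqrt (\<Sum>\<^sub>\<infinity>k\<in>I. (cmod (\<xi> k))\<^sup>2)"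

definition left_regular :: "('a, 'b) monoid_scheme \<Rightarrow> 'a \<Rightarrow> ('a \<Rightarrow> complex) \<Rightarrow> 'a \<Rightarrow> complex"
  where "left_regular G g \<xi> = (\<lambda>k. \<xi> (inv\<^bsub>G\<^esub> g \<otimes>\<^bsub>G\<^esub> k))"

definition ell2_cocycle :: "('a, 'b) monoid_scheme \<Rightarrow> ('a \<Rightarrow> 'a \<Rightarrow> complex) \<Rightarrow> bool"
  where "ell2_cocycle G c \<longleftrightarrow>
    (\<forall>g\<in>carrier G. c g \<in> ell2 (carrier G)) \<and>
    (\<forall>g\<in>carrier G. \<forall>h\<in>carrier G. \<forall>k\<in>carrier G.
       c (g \<otimes>\<^bsub>G\<^esub> h) k = c g k + left_regular G g (c h) k)"

definition folner_sequence :: "('a, 'b) monoid_scheme \<Rightarrow> (nat \<Rightarrow> 'a set) \<Rightarrow> bool"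
  where "folner_sequence G A \<longleftrightarrow>
    (\<forall>n. A n \<subseteq> carrier G \<and> finite (A n) \<and> A n \<noteq> {}) \<and>
    (\<forall>g\<in>carrier G.
       (\<lambda>n. real (card (sym_diff (g <#\<^bsub>G\<^esub> A n) (A n))) / real (card (A n))) \<longlonglongrightarrow> 0)"

text \<open>
  Amenability in the sense of Folner. This is the appropriate notion for countable groups only:
  an uncountable group has no Folner sequence.
\<close>

definition amenable :: "('a, 'b) monoid_scheme \<Rightarrow> bool"
  where "amenable G \<longleftrightarrow> (\<exists>A. folner_sequence G A)"

end

theory Submission
  imports Defs
begin

text \<open>
  The function \<open>F = \<Sum>\<^sub>n \<epsilon>\<^sub>n 1\<^bsub>A\<^sub>n\<^esub> / \<surd>|A\<^sub>n|\<close> is a sum of orthogonal vectors of norm \<open>\<epsilon>\<^sub>n\<close>. It is not square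
  summable, but each of its differences \<open>c\<^sub>g = F - g F\<close> can be, because the unit vectors
  \<open>1\<^bsub>A\<^sub>n\<^esub> / \<surd>|A\<^sub>n|\<close> are asymptotically invariant. So \<open>c\<close> is formally a coboundary, and the cocycle
  identity is automatic.

  Upper bound. With \<open>d\<^sub>n(g) = |g A\<^sub>n \<triangle> A\<^sub>n| / |A\<^sub>n| \<le> 2\<close>, the triangle inequality gives
  \<open>\<parallel>c\<^sub>g\<parallel> \<le> \<Sum>\<^sub>n \<epsilon>\<^sub>n \<surd>d\<^sub>n(g)\<close>. The weights \<open>\<epsilon>\<^sub>n = \<delta> / (2 \<surd>(n+1))\<close> can be fixed in advance. Put
  \<open>\<kappa>\<^sub>n = 4 \<Sum>\<^bsub>j\<le>n\<^esub> \<epsilon>\<^sub>j\<close>. Only finitely many \<open>g\<close> satisfy \<open>\<phi>(g) \<le> \<kappa>\<^sub>n\<close>, so a sufficiently late member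
  of the Folner sequence can serve as \<open>A\<^sub>n\<close> and satisfy \<open>\<epsilon>\<^sub>n \<surd>d\<^sub>n(g) \<le> 2\<^sup>-\<^sup>n\<^sup>-\<^sup>2 \<phi>(g)\<close> for all of those
  \<open>g \<noteq> e\<close>. For a given \<open>g\<close>, the indices \<open>n\<close> with \<open>\<phi>(g) \<le> \<kappa>\<^sub>n\<close> then contribute at most
  \<open>\<phi>(g)/2\<close>, and the remaining ones at most \<open>\<surd>2 \<Sum> \<epsilon>\<^sub>n \<le> 2 \<phi>(g)/4\<close> by the choice of \<open>\<kappa>\<^sub>n\<close>
  (\<open>split_sum_bound\<close>).

  Properness. \<open>F\<close> tends to zero at infinity and has infinite norm. On a finite set \<open>S\<close> on which
  \<open>F\<close> is positive, the translate \<open>g F\<close> is at most \<open>F/2\<close> as soon as \<open>g\<close> lies outside a suitable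
  finite set, so that \<open>\<parallel>c\<^sub>g\<parallel>\<^sup>2 \<ge> \<Sum>\<^bsub>k\<in>S\<^esub> F(k)\<^sup>2 / 4\<close>; and the right-hand side is arbitrarily large
  (\<open>proper_coboundary\<close>).

  The first assertion follows from the second, since the members of a Folner sequence in an infinite
  group can be made disjoint by right translations, which commute with the left action
  (\<open>disjoint_folner_sequence\<close>).
\<close>

section \<open>Square-summable families and finite sections\<close>

lemma ell2_if_bounded_sections:
  assumes "\<And>S. finite S \<Longrightarrow> S \<subseteq> I \<Longrightarrow> L2_set (\<lambda>k. cmod (\<xi> k)) S \<le> C"
  shows "\<xi> \<in> ell2 I" and "ell2_norm I \<xi> \<le> C"
proof -
  have C0: "0 \<le> C"
    using assms[of "{}"] by simp
  have bound: "(\<Sum>k\<in>S. (cmod (\<xi> k))\<^sup>2) \<le> C\<^sup>2" if "finite S" "S \<subseteq> I" for S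
    using assms[OF that] C0 by (simp add: L2_set_def sqrt_le_D)
  have sum: "(\<lambda>k. (cmod (\<xi> k))\<^sup>2) summable_on I"
    by (rule nonneg_bdd_above_summable_on) (auto intro!: bdd_aboveI2 bound)
  then show "\<xi> \<in> ell2 I"
    by (simp add: ell2_def)
  have "(\<Sum>\<^sub>\<infinity>k\<in>I. (cmod (\<xi> k))\<^sup>2) \<le> C\<^sup>2"
    by (rule infsum_le_finite_sums[OF sum bound])
  then show "ell2_norm I \<xi> \<le> C"
    unfolding ell2_norm_def using C0 by (simp add: real_le_lsqrt infsum_nonneg)
qed

lemma L2_set_le_ell2_norm:
  assumes "\<xi> \<in> ell2 I" "finite S" "S \<subseteq> I"
  shows "L2_set (\<lambda>k. cmod (\<xi> k)) S \<le> ell2_norm I \<xi>"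
  unfolding L2_set_def ell2_norm_def
  using assms by (intro real_sqrt_le_mono finite_sum_le_infsum) (auto simp: ell2_def)

lemma L2_set_sum_le:
  "L2_set (\<lambda>k. \<Sum>n\<in>J. h n k) S \<le> (\<Sum>n\<in>J. L2_set (h n) S)"
proof (induction J rule: infinite_finite_induct)
  case (insert n J)
  have "L2_set (\<lambda>k. h n k + (\<Sum>n\<in>J. h n k)) S
      \<le> L2_set (h n) S + L2_set (\<lambda>k. \<Sum>n\<in>J. h n k) S"
    by (rule L2_set_triangle_ineq)
  with insert show ?case by simp
qed (auto simp: L2_set_def)

section \<open>Differences of translates as cocycles\<close>

definition coboundary :: "('a, 'b) monoid_scheme \<Rightarrow> ('a \<Rightarrow> real) \<Rightarrow> 'a \<Rightarrow> 'a \<Rightarrow> complex"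
  where "coboundary G F g k = complex_of_real (F k - F (inv\<^bsub>G\<^esub> g \<otimes>\<^bsub>G\<^esub> k))"

lemma ell2_cocycle_coboundary:
  assumes "group G" and "\<And>g. g \<in> carrier G \<Longrightarrow> coboundary G F g \<in> ell2 (carrier G)"
  shows "ell2_cocycle G (coboundary G F)"
proof -
  interpret group G by fact
  show ?thesis
    using assms(2)
    by (auto simp: ell2_cocycle_def coboundary_def left_regular_def inv_mult_group m_assoc)
qed

text \<open>
  If \<open>F\<close> vanishes at infinity, a translate \<open>g F\<close> far out is small on any given finite set, so \<open>F\<close>
  and \<open>g F\<close> are almost orthogonal there. Hence, for all but finitely many \<open>g\<close>, \<open>\<parallel>F - g F\<parallel>\<close> is at least half
  the norm of that finite section of \<open>F\<close>.
\<close>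

lemma proper_coboundary:
  fixes G (structure)
  assumes "group G"
    and l2: "\<And>g. g \<in> carrier G \<Longrightarrow> coboundary G F g \<in> ell2 (carrier G)"
    and nonneg: "\<And>k. k \<in> carrier G \<Longrightarrow> 0 \<le> F k"
    and vanish: "\<And>t. 0 < t \<Longrightarrow> finite {k \<in> carrier G. t \<le> F k}"
    and large: "\<And>R. \<exists>S. finite S \<and> S \<subseteq> carrier G \<and> R \<le> L2_set F S"
  shows "proper_on (carrier G) (\<lambda>g. ell2_norm (carrier G) (coboundary G F g))"
  unfolding proper_on_def
proof (intro allI impI)
  interpret group G by fact
  fix \<kappa> :: real assume "0 < \<kappa>"
  obtain S' where S': "finite S'" "S' \<subseteq> carrier G" "2 * \<kappa> + 1 \<le> L2_set F S'"
    using large by blast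
  define S where "S = {k \<in> S'. 0 < F k}"
  have S: "finite S" "S \<subseteq> carrier G" "\<And>k. k \<in> S \<Longrightarrow> 0 < F k"
    using S' by (auto simp: S_def)
  have "L2_set F S' = L2_set F S"
    unfolding L2_set_def S_def using S' nonneg
    by (intro arg_cong[where f = sqrt] sum.mono_neutral_right) (auto simp: less_le)
  with S' have big: "2 * \<kappa> + 1 \<le> L2_set F S" by simp
  \<comment> \<open>Half of the smallest value of \<open>F\<close> on \<open>S\<close>; the inserted \<open>1\<close> covers an empty \<open>S\<close>.\<close>
  define t where "t = Min (insert 1 (F ` S)) / 2"
  have t: "0 < t" "\<And>k. k \<in> S \<Longrightarrow> 2 * t \<le> F k"
    using S by (auto simp: t_def)
  define T where "T = {k \<in> carrier G. t \<le> F k}"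
  have "finite T" unfolding T_def by (rule vanish) fact
  have "g \<in> (\<lambda>(k, l). k \<otimes> inv l) ` (S \<times> T)"
    if g: "g \<in> carrier G" and le: "ell2_norm (carrier G) (coboundary G F g) \<le> \<kappa>" for g
  proof (rule ccontr)
    assume out: "g \<notin> (\<lambda>(k, l). k \<otimes> inv l) ` (S \<times> T)"
    have half: "F k / 2 \<le> cmod (coboundary G F g k)" if k: "k \<in> S" for k
    proof -
      have kc: "k \<in> carrier G" using k S by auto
      have "k \<otimes> inv (inv g \<otimes> k) = g"
        using g kc by (simp add: inv_mult_group m_assoc[symmetric])
      then have "inv g \<otimes> k \<notin> T"
        using out k by (force simp: image_iff)
      then have "F (inv g \<otimes> k) < t"
        using g kc by (auto simp: T_def)
      with t(2)[OF k] show ?thesis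
        unfolding coboundary_def norm_of_real by linarith
    qed
    have "L2_set F S / 2 = L2_set (\<lambda>k. F k / 2) S"
      using L2_set_left_distrib[of "1/2" F S] by simp
    also have "\<dots> \<le> L2_set (\<lambda>k. cmod (coboundary G F g k)) S"
      using half S by (intro L2_set_mono) (auto simp: less_imp_le)
    also have "\<dots> \<le> \<kappa>"
      using L2_set_le_ell2_norm[OF l2[OF g] S(1,2)] le by linarith
    finally show False using big by linarith
  qed
  then have "{g \<in> carrier G. ell2_norm (carrier G) (coboundary G F g) \<le> \<kappa>}
      \<subseteq> (\<lambda>(k, l). k \<otimes> inv l) ` (S \<times> T)"
    by blast
  then show "finite {g \<in> carrier G. ell2_norm (carrier G) (coboundary G F g) \<le> \<kappa>}"
    by (rule finite_subset) (use \<open>finite T\<close> S in auto)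
qed

section \<open>Weighted sums of normalised indicator functions\<close>

definition displacement :: "('a, 'b) monoid_scheme \<Rightarrow> 'a \<Rightarrow> 'a set \<Rightarrow> real"
  where "displacement G g A = real (card (sym_diff (g <#\<^bsub>G\<^esub> A) A)) / real (card A)"

lemma displacement_le_2:
  assumes "finite A" shows "displacement G g A \<le> 2"
proof -
  have eq: "g <#\<^bsub>G\<^esub> A = (\<lambda>h. g \<otimes>\<^bsub>G\<^esub> h) ` A"
    by (auto simp: l_coset_def)
  have "card (sym_diff (g <#\<^bsub>G\<^esub> A) A) \<le> card ((g <#\<^bsub>G\<^esub> A) \<union> A)"
    using assms by (intro card_mono) (auto simp: eq)
  also have "\<dots> \<le> card (g <#\<^bsub>G\<^esub> A) + card A"
    by (rule card_Un_le)
  also have "\<dots> \<le> card A + card A"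
    using card_image_le[OF assms] by (simp add: eq)
  finally show ?thesis
    by (auto simp: displacement_def divide_le_eq)
qed

lemma displacement_nonneg: "0 \<le> displacement G g A"
  by (simp add: displacement_def)

text \<open>
  The translate of \<open>1\<^sub>A\<close> by \<open>g\<close> is the indicator of \<open>g A\<close>, so the squared difference is the indicator of
  the symmetric difference.
\<close>

lemma L2_set_indicator_diff_le:
  fixes G (structure) and a :: real
  assumes "group G" "g \<in> carrier G" "A \<subseteq> carrier G" "finite A"
    and S: "finite S" "S \<subseteq> carrier G" and "0 \<le> a"
  shows "L2_set (\<lambda>k. a / sqrt (card A) * (indicator A k - indicator A (inv g \<otimes> k))) S
      \<le> a * sqrt (displacement G g A)"
proof -
  interpret group G by fact
  let ?D = "sym_diff (g <# A) A"
  have finD: "finite ?D"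
    using assms by (auto simp: l_coset_def)
  have mem: "inv g \<otimes> k \<in> A \<longleftrightarrow> k \<in> g <# A" if "k \<in> carrier G" for k
  proof
    assume "inv g \<otimes> k \<in> A"
    moreover have "g \<otimes> (inv g \<otimes> k) = k"
      using that assms(2) by (simp add: m_assoc[symmetric])
    ultimately show "k \<in> g <# A" by (force simp: l_coset_def)
  next
    assume "k \<in> g <# A"
    then obtain h where "h \<in> A" "k = g \<otimes> h" by (auto simp: l_coset_def)
    moreover have "inv g \<otimes> (g \<otimes> h) = h"
      using \<open>h \<in> A\<close> assms(2,3) by (simp add: m_assoc[symmetric] subset_iff)
    ultimately show "inv g \<otimes> k \<in> A" by simp
  qed
  have sq: "(indicator A k - indicator A (inv g \<otimes> k) :: real)\<^sup>2 = indicator ?D k" if "k \<in> S" for k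
    using mem[of k] that S by (auto simp: indicator_def)
  have "(\<Sum>k\<in>S. (indicator A k - indicator A (inv g \<otimes> k) :: real)\<^sup>2) = (\<Sum>k\<in>S. indicator ?D k)"
    by (rule sum.cong) (auto simp: sq)
  also have "\<dots> = card (S \<inter> ?D)"
    using sum_mult_indicator[OF S(1), of "\<lambda>_. 1 :: real" "\<lambda>_. ?D" id] by (simp add: Int_def)
  also have "\<dots> \<le> card ?D"
    using finD by (intro of_nat_mono card_mono) auto
  finally have "L2_set (\<lambda>k. indicator A k - indicator A (inv g \<otimes> k)) S \<le> sqrt (card ?D)"
    unfolding L2_set_def by (rule real_sqrt_le_mono)
  then have "a / sqrt (card A) * L2_set (\<lambda>k. indicator A k - indicator A (inv g \<otimes> k)) S
      \<le> a / sqrt (card A) * sqrt (card ?D)"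
    using \<open>0 \<le> a\<close> by (intro mult_left_mono) auto
  then show ?thesis
    using \<open>0 \<le> a\<close>
    by (subst L2_set_right_distrib[symmetric]) (simp_all add: displacement_def real_sqrt_divide)
qed

text \<open>
  For a disjoint family \<open>A\<close> the sum has at most one term; writing it as a sum makes truncation to
  finitely many indices a matter of enlarging the index set.
\<close>

definition weighted_steps :: "(nat \<Rightarrow> 'a set) \<Rightarrow> (nat \<Rightarrow> real) \<Rightarrow> 'a \<Rightarrow> real"
  where "weighted_steps A \<epsilon> k = (\<Sum>n | k \<in> A n. \<epsilon> n / sqrt (card (A n)))"

lemma weighted_steps_on:
  assumes "disjoint_family A" "k \<in> A n"
  shows "weighted_steps A \<epsilon> k = \<epsilon> n / sqrt (card (A n))"
proof -
  have "{m. k \<in> A m} = {n}"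
    using assms by (auto simp: disjoint_family_on_def)
  then show ?thesis by (simp add: weighted_steps_def)
qed

lemma weighted_steps_off: "k \<notin> (\<Union>n. A n) \<Longrightarrow> weighted_steps A \<epsilon> k = 0"
  by (simp add: weighted_steps_def)

lemma weighted_steps_truncate:
  assumes "{n. k \<in> A n} \<subseteq> {..<N}"
  shows "weighted_steps A \<epsilon> k = (\<Sum>n<N. \<epsilon> n / sqrt (card (A n)) * indicator (A n) k)"
  unfolding weighted_steps_def using assms
  by (intro sum.mono_neutral_cong_left) (auto simp: indicator_def)

lemma weighted_steps_coboundary_bound:
  fixes G (structure)
  assumes "group G" and g: "g \<in> carrier G" and disj: "disjoint_family A"
    and A: "\<And>n. A n \<subseteq> carrier G" "\<And>n. finite (A n)" and pos: "\<And>n. 0 \<le> \<epsilon> n"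
    and C: "\<And>N. (\<Sum>n<N. \<epsilon> n * sqrt (displacement G g (A n))) \<le> C"
  shows "coboundary G (weighted_steps A \<epsilon>) g \<in> ell2 (carrier G)"
    and "ell2_norm (carrier G) (coboundary G (weighted_steps A \<epsilon>) g) \<le> C"
proof -
  interpret group G by fact
  let ?F = "weighted_steps A \<epsilon>"
  have "L2_set (\<lambda>k. cmod (coboundary G ?F g k)) S \<le> C" if S: "finite S" "S \<subseteq> carrier G" for S
  proof -
    \<comment> \<open>Only finitely many of the sets meet the finite set \<open>S \<union> g\<inverse> S\<close>, so on \<open>S\<close> the series is a
      finite sum.\<close>
    let ?T = "S \<union> (\<lambda>k. inv g \<otimes> k) ` S"
    have fin: "finite {n. k \<in> A n}" for k
    proof (cases "\<exists>m. k \<in> A m")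
      case True
      then obtain m where "k \<in> A m" by blast
      then have "{n. k \<in> A n} \<subseteq> {m}"
        using disj by (auto simp: disjoint_family_on_def)
      then show ?thesis by (rule finite_subset) simp
    qed simp
    have "finite (\<Union>k\<in>?T. {n. k \<in> A n})"
      using S fin by auto
    then obtain N where "(\<Union>k\<in>?T. {n. k \<in> A n}) \<subseteq> {..<N}"
      using finite_nat_iff_bounded by blast
    then have N: "{n. k \<in> A n} \<subseteq> {..<N}" if "k \<in> ?T" for k
      using that by blast
    let ?h = "\<lambda>n k. \<epsilon> n / sqrt (card (A n)) * (indicator (A n) k - indicator (A n) (inv g \<otimes> k))"
    have "?F k - ?F (inv g \<otimes> k) = (\<Sum>n<N. ?h n k)" if "k \<in> S" for k
      using that N[of k] N[of "inv g \<otimes> k"]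
      by (simp add: weighted_steps_truncate[where N = N] sum_subtractf right_diff_distrib)
    then have "L2_set (\<lambda>k. cmod (coboundary G ?F g k)) S = L2_set (\<lambda>k. \<Sum>n<N. ?h n k) S"
      unfolding L2_set_def coboundary_def norm_of_real by simp
    also have "\<dots> \<le> (\<Sum>n<N. L2_set (?h n) S)"
      by (rule L2_set_sum_le)
    also have "\<dots> \<le> (\<Sum>n<N. \<epsilon> n * sqrt (displacement G g (A n)))"
      by (intro sum_mono L2_set_indicator_diff_le assms S)
    also have "\<dots> \<le> C" by (rule C)
    finally show ?thesis .
  qed
  note sections = ell2_if_bounded_sections[OF this]
  show "coboundary G ?F g \<in> ell2 (carrier G)"
    by (rule sections(1))
  show "ell2_norm (carrier G) (coboundary G ?F g) \<le> C"
    by (rule sections(2))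
qed

lemma weighted_steps_nonneg: "(\<And>n. 0 \<le> \<epsilon> n) \<Longrightarrow> 0 \<le> weighted_steps A \<epsilon> k"
  by (simp add: weighted_steps_def sum_nonneg)

lemma weighted_steps_le:
  assumes "disjoint_family A" "k \<in> A n" "finite (A n)" "0 \<le> \<epsilon> n"
  shows "weighted_steps A \<epsilon> k \<le> \<epsilon> n"
proof -
  have "1 \<le> card (A n)"
    using assms(2,3) by (metis One_nat_def Suc_leI card_gt_0_iff empty_iff)
  then have "1 \<le> sqrt (card (A n))" by simp
  then have "\<epsilon> n / sqrt (card (A n)) \<le> \<epsilon> n / 1"
    using assms(4) by (intro divide_left_mono) auto
  then show ?thesis
    by (simp add: weighted_steps_on[OF assms(1,2)])
qed

lemma weighted_steps_vanish:
  assumes disj: "disjoint_family A" and fin: "\<And>n. finite (A n)"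
    and "\<And>n. 0 \<le> \<epsilon> n" and "\<epsilon> \<longlonglongrightarrow> 0" and "0 < t"
  shows "finite {k. t \<le> weighted_steps A \<epsilon> k}"
proof -
  obtain M where M: "\<And>n. M \<le> n \<Longrightarrow> \<epsilon> n < t"
    using order_tendstoD(2)[OF assms(4,5)] by (auto simp: eventually_sequentially)
  have "{k. t \<le> weighted_steps A \<epsilon> k} \<subseteq> (\<Union>n<M. A n)"
  proof
    fix k assume "k \<in> {k. t \<le> weighted_steps A \<epsilon> k}"
    then have k: "t \<le> weighted_steps A \<epsilon> k" by simp
    then obtain n where n: "k \<in> A n"
      using \<open>0 < t\<close> weighted_steps_off[of k A \<epsilon>] by fastforce
    then have "t \<le> \<epsilon> n"
      using weighted_steps_le[of A k n \<epsilon>, OF disj n fin assms(3)] k by linarith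
    then have "n < M" using M[of n] by force
    with n show "k \<in> (\<Union>n<M. A n)" by blast
  qed
  then show ?thesis by (rule finite_subset) (simp add: fin)
qed

lemma sum_weighted_steps_squared:
  assumes disj: "disjoint_family A" and "\<And>n. finite (A n)" "\<And>n. A n \<noteq> {}"
  shows "(\<Sum>k\<in>(\<Union>n<N. A n). (weighted_steps A \<epsilon> k)\<^sup>2) = (\<Sum>n<N. (\<epsilon> n)\<^sup>2)"
proof -
  have "(\<Sum>k\<in>(\<Union>n<N. A n). (weighted_steps A \<epsilon> k)\<^sup>2)
      = (\<Sum>n<N. \<Sum>k\<in>A n. (weighted_steps A \<epsilon> k)\<^sup>2)"
    using assms by (intro sum.UNION_disjoint) (auto simp: disjoint_family_on_def)
  also have "\<dots> = (\<Sum>n<N. (\<epsilon> n)\<^sup>2)"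
  proof (rule sum.cong)
    fix n
    have "(\<Sum>k\<in>A n. (weighted_steps A \<epsilon> k)\<^sup>2) = (\<Sum>k\<in>A n. (\<epsilon> n)\<^sup>2 / card (A n))"
      by (rule sum.cong) (auto simp: weighted_steps_on[OF disj] power_divide)
    then show "(\<Sum>k\<in>A n. (weighted_steps A \<epsilon> k)\<^sup>2) = (\<epsilon> n)\<^sup>2"
      using assms by simp
  qed simp
  finally show ?thesis .
qed

section \<open>The choice of the weights and of the subsequence\<close>

text \<open>
  The order \<open>n\<^sup>-\<^sup>1\<^sup>/\<^sup>2\<close> gives null weights whose squares still form a multiple of the divergent harmonic
  series.
\<close>

lemma inverse_sqrt_weights:
  fixes \<delta> :: real
  assumes "0 < \<delta>"
  defines "\<epsilon> \<equiv> \<lambda>n. \<delta> / (2 * sqrt (real (Suc n)))"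
  shows "\<epsilon> n \<in> {0<..<\<delta>}" and "\<epsilon> \<longlonglongrightarrow> 0"
    and "filterlim (\<lambda>N. \<Sum>n<N. (\<epsilon> n)\<^sup>2) at_top sequentially"
proof -
  have "1 \<le> sqrt (real (Suc n))" by simp
  then have "1 < 2 * sqrt (real (Suc n))" by linarith
  then show "\<epsilon> n \<in> {0<..<\<delta>}"
    using assms by (simp add: \<epsilon>_def divide_less_eq)
  have "filterlim (\<lambda>n. sqrt (real (Suc n))) at_top sequentially"
    using filterlim_compose[OF sqrt_at_top filterlim_real_sequentially]
    by (rule filterlim_sequentially_Suc[THEN iffD2])
  then have "(\<lambda>n. \<delta> / 2 / sqrt (real (Suc n))) \<longlonglongrightarrow> 0"
    by (rule real_tendsto_divide_at_top[OF tendsto_const])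
  then show "\<epsilon> \<longlonglongrightarrow> 0"
    by (simp add: \<epsilon>_def)
  have harm: "(\<Sum>n<N. (\<epsilon> n)\<^sup>2) = \<delta>\<^sup>2 / 4 * harm N" for N
  proof -
    have "(\<Sum>n<N. (\<epsilon> n)\<^sup>2) = \<delta>\<^sup>2 / 4 * (\<Sum>n<N. inverse (real (Suc n)))"
      unfolding sum_distrib_left
      by (rule sum.cong) (auto simp: \<epsilon>_def power_divide power_mult_distrib field_simps)
    also have "(\<Sum>n<N. inverse (real (Suc n))) = harm N"
      unfolding harm_def by (rule sum.reindex_bij_witness[of _ "\<lambda>i. i - 1" Suc]) auto
    finally show ?thesis .
  qed
  show "filterlim (\<lambda>N. \<Sum>n<N. (\<epsilon> n)\<^sup>2) at_top sequentially"
    unfolding harm using assms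
    by (intro filterlim_tendsto_pos_mult_at_top[OF tendsto_const _ harm_at_top]) simp
qed

lemma strict_mono_selection:
  assumes "\<And>n. eventually (P n) sequentially"
  shows "\<exists>r :: nat \<Rightarrow> nat. strict_mono r \<and> (\<forall>n. P n (r n))"
proof -
  obtain N where N: "\<And>n m. N n \<le> m \<Longrightarrow> P n m"
    using assms unfolding eventually_sequentially by metis
  define r where "r = rec_nat (N 0) (\<lambda>n x. max (Suc x) (N (Suc n)))"
  have r: "r 0 = N 0" "r (Suc n) = max (Suc (r n)) (N (Suc n))" for n
    by (simp_all add: r_def)
  have "strict_mono r"
    by (simp add: strict_mono_Suc_iff r less_max_iff_disj)
  moreover have "N n \<le> r n" for n
    by (cases n) (simp_all add: r)
  ultimately show ?thesis using N by blast
qed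

lemma disjoint_family_subsequence:
  fixes r :: "nat \<Rightarrow> nat"
  assumes "disjoint_family A" "strict_mono r"
  shows "disjoint_family (A \<circ> r)"
  using assms by (simp add: disjoint_family_on_def strict_mono_eq)

text \<open>
  The threshold \<open>4 \<Sum>\<^bsub>j\<le>n\<^esub> \<epsilon>\<^sub>j\<close> balances two estimates. Where it is at least \<open>p\<close>, the
  geometric bound applies and costs at most \<open>p/2\<close> in total. The indices at which it is smaller than
  \<open>p\<close> form an initial segment of total weight at most \<open>p/4\<close>, so that the trivial bound
  \<open>\<surd>d\<^sub>n \<le> 2\<close> is affordable there.
\<close>

lemma split_sum_bound:
  fixes \<epsilon> d :: "nat \<Rightarrow> real" and p :: real
  assumes "0 \<le> p" and "\<And>n. 0 \<le> \<epsilon> n" and "\<And>n. 0 \<le> d n" and "\<And>n. d n \<le> 2"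
    and late: "\<And>n. p \<le> 4 * (\<Sum>j\<le>n. \<epsilon> j) \<Longrightarrow> \<epsilon> n * sqrt (d n) \<le> (1/2) ^ (n + 2) * p"
  shows "(\<Sum>n<N. \<epsilon> n * sqrt (d n)) \<le> p"
proof -
  let ?x = "\<lambda>n. \<epsilon> n * sqrt (d n)"
  define L where "L = {n. n < N \<and> p \<le> 4 * (\<Sum>j\<le>n. \<epsilon> j)}"
  define E where "E = {n. n < N \<and> 4 * (\<Sum>j\<le>n. \<epsilon> j) < p}"
  have fin: "finite L" "finite E" by (auto simp: L_def E_def)
  have split: "{..<N} = L \<union> E" "L \<inter> E = {}" by (auto simp: L_def E_def)
  have "sum ?x L \<le> (\<Sum>n\<in>L. (1/2) ^ (n + 2) * p)"
    by (intro sum_mono late) (simp add: L_def)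
  also have "\<dots> \<le> (\<Sum>n<N. (1/2) ^ (n + 2) * p)"
    using \<open>0 \<le> p\<close> by (intro sum_mono2) (auto simp: L_def)
  also have "\<dots> = p / 4 * (\<Sum>n<N. (1/2) ^ n)"
    by (simp add: sum_distrib_left field_simps)
  also have "\<dots> \<le> p / 4 * 2"
    using \<open>0 \<le> p\<close> by (intro mult_left_mono) (simp_all add: sum_gp_strict)
  finally have L: "sum ?x L \<le> p / 2" by simp
  have "sum \<epsilon> E \<le> p / 4"
  proof (cases "E = {}")
    case False
    have "sum \<epsilon> E \<le> (\<Sum>j\<le>Max E. \<epsilon> j)"
      using fin assms(2) by (intro sum_mono2) auto
    moreover have "4 * (\<Sum>j\<le>Max E. \<epsilon> j) < p"
      using Max_in[OF fin(2) False] by (simp add: E_def)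
    ultimately show ?thesis by linarith
  qed (use \<open>0 \<le> p\<close> in simp)
  moreover have "sum ?x E \<le> (\<Sum>n\<in>E. \<epsilon> n * 2)"
  proof (intro sum_mono mult_left_mono assms(2))
    fix n
    show "sqrt (d n) \<le> 2"
      using assms(4)[of n] by (intro real_le_lsqrt) auto
  qed
  ultimately have "sum ?x E \<le> p / 2"
    by (simp flip: sum_distrib_right)
  with L show ?thesis
    by (simp add: split sum.union_disjoint[OF fin split(2)])
qed

section \<open>Disjoint Folner sequences\<close>

text \<open>Right translation is injective and commutes with left multiplication by \<open>g\<close>.\<close>

lemma displacement_r_coset:
  fixes G (structure)
  assumes "group G" "g \<in> carrier G" "h \<in> carrier G" "A \<subseteq> carrier G"
  shows "displacement G g (A #> h) = displacement G g A"
proof -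
  interpret group G by fact
  let ?\<rho> = "\<lambda>a. a \<otimes> h"
  have im: "B #> h = ?\<rho> ` B" for B by (auto simp: r_coset_def)
  have inj: "inj_on ?\<rho> (carrier G)"
    using assms by (auto simp: inj_on_def)
  have gA: "g <# A \<subseteq> carrier G"
    using assms by (auto simp: l_coset_def)
  have "sym_diff (g <# (A #> h)) (A #> h) = sym_diff ((g <# A) #> h) (A #> h)"
    using assms by (simp add: coset_assoc)
  also have "\<dots> = ?\<rho> ` sym_diff (g <# A) A"
    using inj_on_image_set_diff[OF inj, of "g <# A" A] inj_on_image_set_diff[OF inj, of A "g <# A"]
      gA assms(4) by (auto simp: im image_Un)
  finally have "card (sym_diff (g <# (A #> h)) (A #> h)) = card (sym_diff (g <# A) A)"
    using gA assms(4) by (auto intro!: card_image inj_on_subset[OF inj])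
  moreover have "card (A #> h) = card A"
    unfolding im using assms(4) by (intro card_image inj_on_subset[OF inj])
  ultimately show ?thesis by (simp add: displacement_def)
qed

lemma r_coset_avoiding_finite_set:
  fixes G (structure)
  assumes "group G" "infinite (carrier G)" "finite A" "A \<subseteq> carrier G" "finite U"
  shows "\<exists>h\<in>carrier G. (A #> h) \<inter> U = {}"
proof -
  interpret group G by fact
  have "finite ((\<lambda>(a, u). inv a \<otimes> u) ` (A \<times> U))"
    using assms by auto
  then obtain h where h: "h \<in> carrier G" "h \<notin> (\<lambda>(a, u). inv a \<otimes> u) ` (A \<times> U)"
    using assms(2) by (meson finite_subset subsetI)
  have "a \<otimes> h \<notin> U" if "a \<in> A" for a
  proof
    assume "a \<otimes> h \<in> U"
    moreover have "inv a \<otimes> (a \<otimes> h) = h"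
      using that h assms(4) by (simp add: m_assoc[symmetric] subset_iff)
    ultimately show False using h(2) that by (force simp: image_iff)
  qed
  then show ?thesis using h(1) by (auto simp: r_coset_def)
qed

lemma disjoint_folner_sequence:
  fixes G (structure)
  assumes "group G" "infinite (carrier G)" and A: "folner_sequence G A"
  shows "\<exists>B. folner_sequence G B \<and> disjoint_family B"
proof -
  interpret group G by fact
  have An: "A n \<subseteq> carrier G" "finite (A n)" "A n \<noteq> {}" for n
    using A by (auto simp: folner_sequence_def)
  \<comment> \<open>The first component accumulates the union of the translates chosen so far.\<close>
  have "\<exists>f. \<forall>n. (finite (fst (f n)) \<and> snd (f n) \<subseteq> fst (f n) \<and> (\<exists>h\<in>carrier G. snd (f n) = A n #> h))
      \<and> (fst (f n) \<subseteq> fst (f (Suc n)) \<and> snd (f (Suc n)) \<inter> fst (f n) = {})"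
  proof (rule dependent_nat_choice)
    show "\<exists>x. finite (fst x) \<and> snd x \<subseteq> fst x \<and> (\<exists>h\<in>carrier G. snd x = A 0 #> h)"
      using An[of 0] by (intro exI[of _ "(A 0 #> \<one>, A 0 #> \<one>)"]) (auto simp: r_coset_def)
  next
    fix x :: "'a set \<times> 'a set" and n
    assume x: "finite (fst x) \<and> snd x \<subseteq> fst x \<and> (\<exists>h\<in>carrier G. snd x = A n #> h)"
    then obtain h where h: "h \<in> carrier G" "(A (Suc n) #> h) \<inter> fst x = {}"
      using r_coset_avoiding_finite_set[OF assms(1,2), of "A (Suc n)" "fst x"] An by blast
    have "finite (A (Suc n) #> h)"
      using An by (auto simp: r_coset_def)
    then show "\<exists>y. (finite (fst y) \<and> snd y \<subseteq> fst y \<and> (\<exists>h\<in>carrier G. snd y = A (Suc n) #> h))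
        \<and> (fst x \<subseteq> fst y \<and> snd y \<inter> fst x = {})"
      using x h by (intro exI[of _ "(fst x \<union> (A (Suc n) #> h), A (Suc n) #> h)"]) auto
  qed
  then obtain f where f: "\<And>n. snd (f n) \<subseteq> fst (f n)" "\<And>n. \<exists>h\<in>carrier G. snd (f n) = A n #> h"
      "\<And>n. fst (f n) \<subseteq> fst (f (Suc n))" "\<And>n. snd (f (Suc n)) \<inter> fst (f n) = {}"
    by blast
  define B where "B n = snd (f n)" for n
  have lt: "B m \<inter> B n = {}" if "m < n" for m n :: nat
  proof -
    obtain n' where n': "n = Suc n'" "m \<le> n'" using \<open>m < n\<close> by (cases n) (auto simp: less_Suc_eq_le)
    have "B m \<subseteq> fst (f n')"
      using f(1)[of m] lift_Suc_mono_le[of "\<lambda>n. fst (f n)", OF f(3) n'(2)] by (auto simp: B_def)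
    then show ?thesis using f(4)[of n'] n'(1) by (auto simp: B_def)
  qed
  have "disjoint_family B"
    unfolding disjoint_family_on_def
  proof (intro ballI impI)
    fix m n :: nat assume "m \<noteq> n"
    then show "B m \<inter> B n = {}"
      using lt[of m n] lt[of n m] by (cases "m < n") auto
  qed
  moreover have "folner_sequence G B"
    unfolding folner_sequence_def
  proof (intro conjI allI ballI)
    fix n
    obtain h where h: "h \<in> carrier G" "B n = A n #> h" using f(2)[of n] by (auto simp: B_def)
    show "B n \<subseteq> carrier G" using h An(1)[of n] by (auto simp: r_coset_def)
    show "finite (B n)" using h An(2)[of n] by (auto simp: r_coset_def)
    show "B n \<noteq> {}" using h An(3)[of n] by (auto simp: r_coset_def)
  next
    fix g assume g: "g \<in> carrier G"
    have "displacement G g (B n) = displacement G g (A n)" for n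
      using f(2)[of n] displacement_r_coset[OF assms(1) g _ An(1)[of n]] by (auto simp: B_def)
    moreover have "(\<lambda>n. displacement G g (A n)) \<longlonglongrightarrow> 0"
      using A g by (simp add: folner_sequence_def displacement_def)
    ultimately have "(\<lambda>n. displacement G g (B n)) \<longlonglongrightarrow> 0" by simp
    then show "(\<lambda>n. real (card (sym_diff (g <# B n) (B n))) / real (card (B n))) \<longlonglongrightarrow> 0"
      by (simp add: displacement_def)
  qed
  ultimately show ?thesis by blast
qed

section \<open>Proper cocycles of prescribed growth\<close>

text \<open>
  The weights are prescribed and only the subsequence is chosen: the requirements on \<open>r n\<close> concern the
  finite set \<open>K n\<close>, which depends on the weights but not on the earlier choices.
\<close>

lemma proper_cocycle_along_subsequence:
  fixes G :: "('a, 'b) monoid_scheme" (structure) and \<phi> :: "'a \<Rightarrow> real"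
  assumes "group G"
    and nonneg: "\<And>g. g \<in> carrier G \<Longrightarrow> 0 \<le> \<phi> g"
    and proper: "proper_on (carrier G) \<phi>"
    and pos: "\<And>g. g \<in> carrier G \<Longrightarrow> g \<noteq> \<one> \<Longrightarrow> 0 < \<phi> g"
    and A: "folner_sequence G A" and disj: "disjoint_family A"
    and eps: "\<And>n. 0 < \<epsilon> n" "\<epsilon> \<longlonglongrightarrow> 0" "filterlim (\<lambda>N. \<Sum>n<N. (\<epsilon> n)\<^sup>2) at_top sequentially"
  obtains r :: "nat \<Rightarrow> nat" where "strict_mono r"
    and "ell2_cocycle G (coboundary G (weighted_steps (A \<circ> r) \<epsilon>))"
    and "\<And>g. g \<in> carrier G \<Longrightarrow>
      ell2_norm (carrier G) (coboundary G (weighted_steps (A \<circ> r) \<epsilon>) g) \<le> \<phi> g"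
    and "proper_on (carrier G)
      (\<lambda>g. ell2_norm (carrier G) (coboundary G (weighted_steps (A \<circ> r) \<epsilon>) g))"
proof -
  interpret group G by fact
  have An: "A n \<subseteq> carrier G" "finite (A n)" "A n \<noteq> {}" for n
    using A by (auto simp: folner_sequence_def)
  have fol: "(\<lambda>n. displacement G g (A n)) \<longlonglongrightarrow> 0" if "g \<in> carrier G" for g
    using A that by (simp add: folner_sequence_def displacement_def)
  define K where "K n = {g \<in> carrier G. \<phi> g \<le> 4 * (\<Sum>j\<le>n. \<epsilon> j)}" for n
  have ev: "eventually (\<lambda>m. \<forall>g\<in>K n. \<epsilon> n * sqrt (displacement G g (A m)) \<le> (1/2) ^ (n + 2) * \<phi> g)
      sequentially" for n
  proof (rule eventually_ball_finite)
    have "0 < (\<Sum>j\<le>n. \<epsilon> j)"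
      by (intro sum_pos eps) auto
    then show "finite (K n)"
      using proper by (simp add: K_def proper_on_def)
    show "\<forall>g\<in>K n. eventually (\<lambda>m. \<epsilon> n * sqrt (displacement G g (A m)) \<le> (1/2) ^ (n + 2) * \<phi> g)
        sequentially"
    proof
      fix g assume "g \<in> K n"
      then have g: "g \<in> carrier G" by (simp add: K_def)
      show "eventually (\<lambda>m. \<epsilon> n * sqrt (displacement G g (A m)) \<le> (1/2) ^ (n + 2) * \<phi> g)
          sequentially"
      proof (cases "g = \<one>")
        case True
        have "displacement G g (A m) = 0" for m
          using True An(1)[of m] by (simp add: displacement_def lcos_mult_one)
        then show ?thesis using nonneg[OF g] by simp
      next
        case False
        have "(\<lambda>m. \<epsilon> n * sqrt (displacement G g (A m))) \<longlonglongrightarrow> \<epsilon> n * sqrt 0"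
          by (intro tendsto_intros fol g)
        moreover have "\<epsilon> n * sqrt 0 < (1/2) ^ (n + 2) * \<phi> g"
          using pos[OF g False] by simp
        ultimately have "eventually (\<lambda>m. \<epsilon> n * sqrt (displacement G g (A m))
            < (1/2) ^ (n + 2) * \<phi> g) sequentially"
          by (rule order_tendstoD(2))
        then show ?thesis by (rule eventually_mono) simp
      qed
    qed
  qed
  obtain r :: "nat \<Rightarrow> nat" where r: "strict_mono r"
    and sel: "\<And>n g. g \<in> K n \<Longrightarrow> \<epsilon> n * sqrt (displacement G g (A (r n))) \<le> (1/2) ^ (n + 2) * \<phi> g"
    using strict_mono_selection[of "\<lambda>n m. \<forall>g\<in>K n.
      \<epsilon> n * sqrt (displacement G g (A m)) \<le> (1/2) ^ (n + 2) * \<phi> g", OF ev] by blast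
  have B: "(A \<circ> r) n \<subseteq> carrier G" "finite ((A \<circ> r) n)" "(A \<circ> r) n \<noteq> {}" for n
    using An by auto
  have disjB: "disjoint_family (A \<circ> r)"
    using disj r by (rule disjoint_family_subsequence)
  have eps0: "0 \<le> \<epsilon> n" for n using eps(1)[of n] by simp
  let ?F = "weighted_steps (A \<circ> r) \<epsilon>"
  have bound: "(\<Sum>n<N. \<epsilon> n * sqrt (displacement G g ((A \<circ> r) n))) \<le> \<phi> g" if g: "g \<in> carrier G" for g N
    using sel[of g] g
    by (intro split_sum_bound nonneg eps0 displacement_nonneg displacement_le_2 B)
      (auto simp: K_def)
  note norm = weighted_steps_coboundary_bound[OF \<open>group G\<close> _ disjB B(1,2) eps0 bound]
  have large: "\<exists>S. finite S \<and> S \<subseteq> carrier G \<and> R \<le> L2_set ?F S" for R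
  proof -
    obtain N where "R\<^sup>2 \<le> (\<Sum>n<N. (\<epsilon> n)\<^sup>2)"
      using eps(3) by (metis eventually_sequentially filterlim_at_top order_refl)
    then have "R\<^sup>2 \<le> (\<Sum>k\<in>(\<Union>n<N. (A \<circ> r) n). (?F k)\<^sup>2)"
      by (simp only: sum_weighted_steps_squared[OF disjB B(2,3)])
    then have "R \<le> L2_set ?F (\<Union>n<N. (A \<circ> r) n)"
      unfolding L2_set_def by (rule real_le_rsqrt)
    then show ?thesis using B by (intro exI[of _ "\<Union>n<N. (A \<circ> r) n"]) blast
  qed
  show ?thesis
  proof
    show "strict_mono r" by fact
    show "ell2_cocycle G (coboundary G ?F)"
      by (rule ell2_cocycle_coboundary[OF \<open>group G\<close> norm(1)])
    show "ell2_norm (carrier G) (coboundary G ?F g) \<le> \<phi> g" if "g \<in> carrier G" for g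
      by (rule norm(2)[OF that that])
    show "proper_on (carrier G) (\<lambda>g. ell2_norm (carrier G) (coboundary G ?F g))"
    proof (rule proper_coboundary[OF \<open>group G\<close> norm(1) weighted_steps_nonneg[OF eps0] _ large])
      show "finite {k \<in> carrier G. t \<le> ?F k}" if "0 < t" for t
        by (rule finite_subset[OF _ weighted_steps_vanish[OF disjB B(2) eps0 eps(2) that]]) blast
    qed
  qed
qed

theorem proposition6p8:
  fixes G :: "('a, 'b) monoid_scheme" and \<phi> :: "'a \<Rightarrow> real"
  assumes "group G"
    and "countable (carrier G)"
    and "infinite (carrier G)"
    and "amenable G"
    and "\<And>g. g \<in> carrier G \<Longrightarrow> 0 \<le> \<phi> g"
    and "proper_on (carrier G) \<phi>"
    and "\<And>g. g \<in> carrier G \<Longrightarrow> g \<noteq> \<one>\<^bsub>G\<^esub> \<Longrightarrow> 0 < \<phi> g"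
  shows "(\<exists>c. ell2_cocycle G c
            \<and> (\<forall>g\<in>carrier G. ell2_norm (carrier G) (c g) \<le> \<phi> g)
            \<and> proper_on (carrier G) (\<lambda>g. ell2_norm (carrier G) (c g)))
    \<and> (\<forall>A (\<delta>::real). folner_sequence G A \<longrightarrow> disjoint_family A \<longrightarrow> 0 < \<delta> \<longrightarrow>
         (\<exists>(r :: nat \<Rightarrow> nat) (\<epsilon> :: nat \<Rightarrow> real) (F :: 'a \<Rightarrow> real) c.
            strict_mono r
          \<and> (\<forall>n. \<epsilon> n \<in> {0<..<\<delta>})
          \<and> \<epsilon> \<longlonglongrightarrow> 0
          \<and> filterlim (\<lambda>N. \<Sum>n<N. (\<epsilon> n)\<^sup>2) at_top sequentially
          \<and> (\<forall>n. \<forall>g\<in>A (r n). F g = \<epsilon> n / sqrt (real (card (A (r n)))))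
          \<and> (\<forall>g\<in>carrier G. g \<notin> (\<Union>n. A (r n)) \<longrightarrow> F g = 0)
          \<and> (\<forall>g\<in>carrier G. F g \<in> {0..<\<delta>})
          \<and> (\<forall>g\<in>carrier G. \<forall>k\<in>carrier G.
               c g k = complex_of_real (F k - F (inv\<^bsub>G\<^esub> g \<otimes>\<^bsub>G\<^esub> k)))
          \<and> ell2_cocycle G c
          \<and> (\<forall>g\<in>carrier G. ell2_norm (carrier G) (c g) \<le> \<phi> g)
          \<and> proper_on (carrier G) (\<lambda>g. ell2_norm (carrier G) (c g))))"
proof -
  let ?P = "\<lambda>c. ell2_cocycle G c
            \<and> (\<forall>g\<in>carrier G. ell2_norm (carrier G) (c g) \<le> \<phi> g)
            \<and> proper_on (carrier G) (\<lambda>g. ell2_norm (carrier G) (c g))"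
  let ?Q = "\<lambda>A (\<delta>::real) r (\<epsilon> :: nat \<Rightarrow> real) (F :: 'a \<Rightarrow> real) c. strict_mono (r :: nat \<Rightarrow> nat)
          \<and> (\<forall>n. \<epsilon> n \<in> {0<..<\<delta>})
          \<and> \<epsilon> \<longlonglongrightarrow> 0
          \<and> filterlim (\<lambda>N. \<Sum>n<N. (\<epsilon> n)\<^sup>2) at_top sequentially
          \<and> (\<forall>n. \<forall>g\<in>A (r n). F g = \<epsilon> n / sqrt (real (card (A (r n)))))
          \<and> (\<forall>g\<in>carrier G. g \<notin> (\<Union>n. A (r n)) \<longrightarrow> F g = 0)
          \<and> (\<forall>g\<in>carrier G. F g \<in> {0..<\<delta>})
          \<and> (\<forall>g\<in>carrier G. \<forall>k\<in>carrier G.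
               c g k = complex_of_real (F k - F (inv\<^bsub>G\<^esub> g \<otimes>\<^bsub>G\<^esub> k)))
          \<and> ?P c"
  have main: "\<exists>r \<epsilon> F c. ?Q A \<delta> r \<epsilon> F c"
    if A: "folner_sequence G A" and disj: "disjoint_family A" and \<delta>: "0 < \<delta>" for A \<delta>
  proof -
    define \<epsilon> where "\<epsilon> n = \<delta> / (2 * sqrt (real (Suc n)))" for n
    note \<epsilon> = inverse_sqrt_weights[OF \<delta>, folded \<epsilon>_def]
    have \<epsilon>_pos: "0 < \<epsilon> n" and \<epsilon>_less: "\<epsilon> n < \<delta>" for n
      using \<epsilon>(1)[of n] by auto
    obtain r where r: "strict_mono r"
      and P: "ell2_cocycle G (coboundary G (weighted_steps (A \<circ> r) \<epsilon>))"
        "\<And>g. g \<in> carrier G \<Longrightarrow>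
          ell2_norm (carrier G) (coboundary G (weighted_steps (A \<circ> r) \<epsilon>) g) \<le> \<phi> g"
        "proper_on (carrier G)
          (\<lambda>g. ell2_norm (carrier G) (coboundary G (weighted_steps (A \<circ> r) \<epsilon>) g))"
      using proper_cocycle_along_subsequence[OF assms(1,5,6,7) A disj \<epsilon>_pos \<epsilon>(2,3)]
      by metis
    have disjB: "disjoint_family (A \<circ> r)"
      using disj r by (rule disjoint_family_subsequence)
    have fin: "finite (A n)" for n
      using A by (auto simp: folner_sequence_def)
    let ?F = "weighted_steps (A \<circ> r) \<epsilon>"
    have less: "?F k < \<delta>" for k
    proof (cases "\<exists>n. k \<in> (A \<circ> r) n")
      case True
      then obtain n where n: "k \<in> (A \<circ> r) n" by blast
      have "?F k \<le> \<epsilon> n"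
        using \<epsilon>_pos[of n] fin by (intro weighted_steps_le[OF disjB n]) auto
      with \<epsilon>_less[of n] show ?thesis by simp
    next
      case False
      then show ?thesis using weighted_steps_off[of k "A \<circ> r" \<epsilon>] \<delta> by auto
    qed
    have "?Q A \<delta> r \<epsilon> ?F (coboundary G ?F)"
    proof (intro conjI allI ballI impI)
      show "?F g = \<epsilon> n / sqrt (real (card (A (r n))))" if "g \<in> A (r n)" for n g
        using weighted_steps_on[OF disjB, of g n \<epsilon>] that by simp
      show "?F g = 0" if "g \<notin> (\<Union>n. A (r n))" for g
        using weighted_steps_off[of g "A \<circ> r" \<epsilon>] that by simp
      show "?F g \<in> {0..<\<delta>}" for g
        using less[of g] \<epsilon>_pos by (auto intro!: weighted_steps_nonneg simp: less_imp_le)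
      show "coboundary G ?F g k = complex_of_real (?F k - ?F (inv\<^bsub>G\<^esub> g \<otimes>\<^bsub>G\<^esub> k))" for g k
        by (rule coboundary_def)
    qed (rule r \<epsilon> P | assumption)+
    then show ?thesis by blast
  qed
  obtain A\<^sub>0 where "folner_sequence G A\<^sub>0"
    using assms(4) by (auto simp: amenable_def)
  then obtain A where A: "folner_sequence G A" "disjoint_family A"
    using disjoint_folner_sequence[OF assms(1,3)] by blast
  show ?thesis
  proof (intro conjI allI impI)
    show "\<exists>c. ?P c"
      using main[OF A zero_less_one] by blast
  qed (rule main)
qed

end
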